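(* Let $x=\boldsymbol\chi(X)$ be a smooth invertible deformation between regions of $\mathbb R^d$ with smooth inverse, with deformation gradient $F=\nabla_X x$, $J=\det F>0$, and polar decomposition $F=VR$. Suppose the deformation gradient is a pure stretch, i.e. $R=I$ everywhere, so that $F=V$. Then $$K=J,\qquad S=J^{-1}V$$ is an admissible choice of cloak parameters (that is, $S$ is symmetric, non-singular and $\operatorname{div}S=0$), the corresponding density tensor $\rho=J\,S\,V^{-2}S$ is isotropic, namely equal to $J^{-1}I$, and for every smooth scalar function $p$ the Laplacian becomes $$\nabla_X^2 p = V:\nabla\big(V\,\nabla p\big).$$
   Context: $X$ denotes points of the undeformed region and $x$ points of the deformed region; functions are regarded as functions of $X$ or of $x$ through $x=\boldsymbol\chi(X)$. $\nabla_X^2$ is the Laplacian in $X$; $\nabla$ and $\operatorname{div}$ are the gradient and divergence in $x$. Components: $F_{iI}=\partial x_i/\partial X_I$. In the polar decomposition $F=VR$, $R$ is proper orthogonal and $V$ is the positive definite symmetric square root of $FF^t$. For a second-order tensor field $A$, $(\operatorname{div}A)_j=\partial A_{ij}/\partial x_i$; for a vector field $w$, $A:\nabla w=A_{ij}\,\partial w_j/\partial x_i$ (summation convention). Cloak parameters: for a given deformation, a cloak of pentamode type is specified by any symmetric non-singular tensor field $S$ on the deformed region with $\operatorname{div}S=0$; its modulus is $K=J$, its stiffness is $C=K\,S\otimes S$, and its inertia (density) tensor is $\rho=J\,S\,V^{-2}S$. *)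

theory Defs
  imports "HOL-Analysis.Analysis"
begin

definition region :: "'a::topological_space set \<Rightarrow> bool" where
  "region S \<longleftrightarrow> S \<noteq> {} \<and> open S \<and> connected S"

(* Only used with S open; derivatives at points of S are two-sided derivatives. *)
fun Ck_on :: "nat \<Rightarrow> 'a::euclidean_space set \<Rightarrow> ('a \<Rightarrow> 'b::real_normed_vector) \<Rightarrow> bool" where
  "Ck_on 0 S f \<longleftrightarrow> continuous_on S f"
| "Ck_on (Suc k) S f \<longleftrightarrow>
     (\<forall>x\<in>S. f differentiable (at x)) \<and>
     (\<forall>v. Ck_on k S (\<lambda>x. frechet_derivative f (at x) v))"

definition smooth_on :: "'a::euclidean_space set \<Rightarrow> ('a \<Rightarrow> 'b::real_normed_vector) \<Rightarrow> bool" where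
  "smooth_on S f \<longleftrightarrow> (\<forall>k. Ck_on k S f)"

definition smooth_deformation ::
    "(real^'d) set \<Rightarrow> (real^'d) set \<Rightarrow> (real^'d \<Rightarrow> real^'d) \<Rightarrow> (real^'d \<Rightarrow> real^'d) \<Rightarrow> bool" where
  "smooth_deformation \<Omega> \<omega> \<phi> \<xi> \<longleftrightarrow>
     \<phi> ` \<Omega> = \<omega> \<and> \<xi> ` \<omega> = \<Omega> \<and>
     (\<forall>X\<in>\<Omega>. \<xi> (\<phi> X) = X) \<and> (\<forall>x\<in>\<omega>. \<phi> (\<xi> x) = x) \<and>
     smooth_on \<Omega> \<phi> \<and> smooth_on \<omega> \<xi>"

definition partial :: "'d \<Rightarrow> (real^'d \<Rightarrow> real) \<Rightarrow> real^'d \<Rightarrow> real" where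
  "partial i f x = frechet_derivative f (at x) (axis i 1)"

definition grad :: "(real^'d \<Rightarrow> real) \<Rightarrow> real^'d \<Rightarrow> real^'d" where
  "grad f x = (\<chi> i. partial i f x)"

definition laplacian :: "(real^'d \<Rightarrow> real) \<Rightarrow> real^'d \<Rightarrow> real" where
  "laplacian f x = (\<Sum>i\<in>UNIV. partial i (partial i f) x)"

(* The contraction is over the first index of the tensor: (div A)_j = d A_ij / d x_i. *)
definition tensor_div :: "(real^'d \<Rightarrow> real^'d^'d) \<Rightarrow> real^'d \<Rightarrow> real^'d" where
  "tensor_div A x = (\<chi> j. \<Sum>i\<in>UNIV. partial i (\<lambda>y. A y $ i $ j) x)"

definition contract_grad :: "real^'d^'d \<Rightarrow> (real^'d \<Rightarrow> real^'d) \<Rightarrow> real^'d \<Rightarrow> real" where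
  "contract_grad A w x = (\<Sum>i\<in>UNIV. \<Sum>j\<in>UNIV. A $ i $ j * partial i (\<lambda>y. w y $ j) x)"

definition symmetric_matrix :: "real^'d^'d \<Rightarrow> bool" where
  "symmetric_matrix A \<longleftrightarrow> transpose A = A"

definition positive_definite :: "real^'d^'d \<Rightarrow> bool" where
  "positive_definite A \<longleftrightarrow> (\<forall>v. v \<noteq> 0 \<longrightarrow> v \<bullet> (A *v v) > 0)"

definition polar_decomposition :: "real^'d^'d \<Rightarrow> real^'d^'d \<Rightarrow> real^'d^'d \<Rightarrow> bool" where
  "polar_decomposition F V R \<longleftrightarrow>
     F = V ** R \<and> rotation_matrix R \<and>
     symmetric_matrix V \<and> positive_definite V \<and> V ** V = F ** transpose F"

(* J, K and S are fields on the deformed region. Smoothness of S makes the divergence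
   meaningful: frechet_derivative is unspecified at points of non-differentiability. *)
definition admissible_cloak ::
    "(real^'d) set \<Rightarrow> (real^'d \<Rightarrow> real) \<Rightarrow> (real^'d \<Rightarrow> real) \<Rightarrow> (real^'d \<Rightarrow> real^'d^'d) \<Rightarrow> bool" where
  "admissible_cloak \<omega> J K S \<longleftrightarrow>
     (\<forall>x\<in>\<omega>. K x = J x) \<and>
     smooth_on \<omega> S \<and>
     (\<forall>x\<in>\<omega>. symmetric_matrix (S x)) \<and>
     (\<forall>x\<in>\<omega>. invertible (S x)) \<and>
     (\<forall>x\<in>\<omega>. tensor_div S x = 0)"

definition cloak_density :: "real \<Rightarrow> real^'d^'d \<Rightarrow> real^'d^'d \<Rightarrow> real^'d^'d" where
  "cloak_density J V S = J *\<^sub>R (S ** (matrix_inv V ** matrix_inv V) ** S)"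

end

(*
  Let G be the Jacobian of the inverse map \<xi>, so that F = G^(-1) and S = J^(-1) F = det G * G^(-1) is the
  cofactor matrix of G. Its entries are polynomials in the first derivatives of \<xi>, hence smooth.
  Taking the divergence of the matrix identity S G = (det G) I gives
    (div S)_l G_lk + S_il d_i G_lk = d_k (det G).
  By Jacobi's formula d_k (det G) = S_il d_k G_li, and d_k G_li = d_i G_lk because second derivatives
  of \<xi> commute. Hence (div S) G = 0, and div S = 0. For the Laplacian, the X-gradient of p is
  F^t grad p = V grad p because V = F is symmetric, and the chain rule is applied once more.
*)
theory Submission
  imports Defs
begin

section \<open>Closure properties of smooth functions\<close>

text \<open>Since \<open>S\<close> is open, functions that agree on \<open>S\<close> have the same
  derivative at each of its points, so agreement passes to the directional derivatives and the
  induction closes.\<close>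

lemma Ck_on_cong:
  assumes "open S" "Ck_on k S f" "\<And>x. x \<in> S \<Longrightarrow> f x = g x"
  shows "Ck_on k S g"
  using assms(2,3)
proof (induction k arbitrary: f g)
  case 0
  then show ?case by (simp cong: continuous_on_cong)
next
  case (Suc k)
  have d: "f differentiable (at x)" if "x \<in> S" for x using Suc.prems(1) that by auto
  have eq: "frechet_derivative f (at x) = frechet_derivative g (at x)" if "x \<in> S" for x
    using frechet_derivative_transform_within_open[OF d assms(1)] that Suc.prems(2) by blast
  have "g differentiable (at x)" if "x \<in> S" for x
    using d[OF that] has_derivative_transform_within_open[OF _ assms(1) that] Suc.prems(2)
    unfolding differentiable_def by blast
  moreover have "Ck_on k S (\<lambda>x. frechet_derivative g (at x) v)" for v
    using Suc.IH[of "\<lambda>x. frechet_derivative f (at x) v"] Suc.prems(1) eq by simp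
  ultimately show ?case by simp
qed

text \<open>Lets the closure proofs supply an explicit derivative formula. That formula is known to
  equal \<open>frechet_derivative\<close> only on \<open>S\<close>, hence the appeal to
  \<open>Ck_on_cong\<close>.\<close>

lemma Ck_on_SucI:
  assumes "open S" "\<And>x. x \<in> S \<Longrightarrow> (f has_derivative f' x) (at x)"
    and "\<And>v. Ck_on k S (\<lambda>x. f' x v)"
  shows "Ck_on (Suc k) S f"
proof -
  have "frechet_derivative f (at x) = f' x" if "x \<in> S" for x
    using frechet_derivative_at[OF assms(2)[OF that]] by simp
  then have "Ck_on k S (\<lambda>x. frechet_derivative f (at x) v)" for v
    using Ck_on_cong[OF assms(1) assms(3)] by simp
  then show ?thesis using assms(2) by (auto simp: differentiable_def)
qed

lemma Ck_on_imp_continuous_on: "Ck_on k S f \<Longrightarrow> continuous_on S f"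
  by (cases k) (auto intro: differentiable_imp_continuous_on simp: differentiable_on_def
      differentiable_at_withinI)

lemma Ck_on_SucD: "Ck_on (Suc k) S f \<Longrightarrow> Ck_on k S f"
proof (induction k arbitrary: f)
  case 0
  then show ?case using Ck_on_imp_continuous_on[OF 0] by simp
qed auto

lemma Ck_on_const: "Ck_on k S (\<lambda>x. c)"
  by (induction k arbitrary: c) auto

lemma Ck_on_bounded_linear:
  assumes "open S" "bounded_linear L" "Ck_on k S f"
  shows "Ck_on k S (\<lambda>x. L (f x))"
  using assms(3)
proof (induction k arbitrary: f)
  case 0
  then show ?case using bounded_linear.continuous_on[OF assms(2)] by simp
next
  case (Suc k)
  show ?case
  proof (rule Ck_on_SucI[OF assms(1)])
    show "((\<lambda>x. L (f x)) has_derivative (\<lambda>v. L (frechet_derivative f (at x) v))) (at x)"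
      if "x \<in> S" for x
      using Suc.prems that
      by (intro bounded_linear.has_derivative[OF assms(2)]) (simp add: frechet_derivative_works[symmetric])
    show "Ck_on k S (\<lambda>x. L (frechet_derivative f (at x) v))" for v
      using Suc by simp
  qed
qed

lemma Ck_on_add:
  assumes "open S" "Ck_on k S f" "Ck_on k S g"
  shows "Ck_on k S (\<lambda>x. f x + g x)"
  using assms(2,3)
proof (induction k arbitrary: f g)
  case 0
  then show ?case by (simp add: continuous_on_add)
next
  case (Suc k)
  show ?case
  proof (rule Ck_on_SucI[OF assms(1)])
    show "((\<lambda>x. f x + g x) has_derivative
        (\<lambda>v. frechet_derivative f (at x) v + frechet_derivative g (at x) v)) (at x)"
      if "x \<in> S" for x
      using Suc.prems that by (intro has_derivative_add) (simp_all add: frechet_derivative_works[symmetric])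
    show "Ck_on k S (\<lambda>x. frechet_derivative f (at x) v + frechet_derivative g (at x) v)" for v
      using Suc by simp
  qed
qed

lemma Ck_on_mult:
  fixes f g :: "'a::euclidean_space \<Rightarrow> real"
  assumes "open S" "Ck_on k S f" "Ck_on k S g"
  shows "Ck_on k S (\<lambda>x. f x * g x)"
  using assms(2,3)
proof (induction k arbitrary: f g)
  case 0
  then show ?case by (simp add: continuous_on_mult)
next
  case (Suc k)
  show ?case
  proof (rule Ck_on_SucI[OF assms(1)])
    show "((\<lambda>x. f x * g x) has_derivative
        (\<lambda>v. f x * frechet_derivative g (at x) v + frechet_derivative f (at x) v * g x)) (at x)"
      if "x \<in> S" for x
      using Suc.prems that by (intro has_derivative_mult) (simp_all add: frechet_derivative_works[symmetric])
    show "Ck_on k S (\<lambda>x. f x * frechet_derivative g (at x) v + frechet_derivative f (at x) v * g x)" for v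
      \<comment> \<open>The product rule multiplies a derivative, of order \<open>k\<close>, by an
        undifferentiated factor, of order \<open>Suc k\<close>; the latter is lowered to order
        \<open>k\<close> before the induction hypothesis applies.\<close>
      using Suc.prems Ck_on_SucD[OF Suc.prems(1)] Ck_on_SucD[OF Suc.prems(2)]
      by (intro Ck_on_add[OF assms(1)] Suc.IH) auto
  qed
qed

lemma smooth_on_cong:
  "open S \<Longrightarrow> smooth_on S f \<Longrightarrow> (\<And>x. x \<in> S \<Longrightarrow> f x = g x) \<Longrightarrow> smooth_on S g"
  unfolding smooth_on_def using Ck_on_cong by blast

lemma smooth_on_const: "smooth_on S (\<lambda>x. c)"
  by (simp add: smooth_on_def Ck_on_const)

lemma smooth_on_bounded_linear:
  "open S \<Longrightarrow> bounded_linear L \<Longrightarrow> smooth_on S f \<Longrightarrow> smooth_on S (\<lambda>x. L (f x))"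
  by (simp add: smooth_on_def Ck_on_bounded_linear)

lemma smooth_on_mult:
  fixes f g :: "'a::euclidean_space \<Rightarrow> real"
  shows "open S \<Longrightarrow> smooth_on S f \<Longrightarrow> smooth_on S g \<Longrightarrow> smooth_on S (\<lambda>x. f x * g x)"
  by (simp add: smooth_on_def Ck_on_mult)

lemma smooth_on_sum:
  assumes "open S" "\<And>i. i \<in> I \<Longrightarrow> smooth_on S (f i)"
  shows "smooth_on S (\<lambda>x. \<Sum>i\<in>I. f i x)"
  using assms(2)
proof (induction I rule: infinite_finite_induct)
  case (insert i I)
  then show ?case
    by (simp add: smooth_on_def Ck_on_add[OF assms(1)])
qed (simp_all add: smooth_on_const)

lemma smooth_on_prod:
  fixes f :: "'i \<Rightarrow> 'a::euclidean_space \<Rightarrow> real"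
  assumes "open S" "\<And>i. i \<in> I \<Longrightarrow> smooth_on S (f i)"
  shows "smooth_on S (\<lambda>x. \<Prod>i\<in>I. f i x)"
  using assms(2)
proof (induction I rule: infinite_finite_induct)
  case (insert i I)
  then show ?case
    using smooth_on_mult[OF assms(1)] by simp
qed (simp_all add: smooth_on_const)

lemma smooth_on_frechet_derivative:
  assumes "smooth_on S f"
  shows "smooth_on S (\<lambda>x. frechet_derivative f (at x) v)"
proof -
  have "Ck_on (Suc k) S f" for k using assms by (simp only: smooth_on_def)
  then show ?thesis by (simp add: smooth_on_def)
qed

lemma smooth_on_has_derivative:
  assumes "smooth_on S f" "x \<in> S"
  shows "(f has_derivative frechet_derivative f (at x)) (at x)"
proof -
  have "Ck_on (Suc 0) S f" using assms by (simp only: smooth_on_def)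
  then show ?thesis using assms(2) by (simp add: frechet_derivative_works[symmetric])
qed

lemma smooth_on_imp_continuous_on: "smooth_on S f \<Longrightarrow> continuous_on S f"
  unfolding smooth_on_def using Ck_on_imp_continuous_on by blast

text \<open>Expanding in the matrix units \<open>axis i (axis j 1)\<close> writes \<open>f\<close>
  as a finite sum of bounded linear images of its scalar entries.\<close>

lemma smooth_on_matrix:
  fixes f :: "'a::euclidean_space \<Rightarrow> real^'n^'m"
  assumes "open S" "\<And>i j. smooth_on S (\<lambda>x. f x $ i $ j)"
  shows "smooth_on S f"
proof -
  have "smooth_on S (\<lambda>x. \<Sum>i\<in>UNIV. \<Sum>j\<in>UNIV. f x $ i $ j *\<^sub>R (axis i (axis j 1) :: real^'n^'m))"
    by (rule smooth_on_sum[OF assms(1)])+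
       (rule smooth_on_bounded_linear[OF assms(1) bounded_linear_scaleR_left assms(2)])
  moreover have "(\<Sum>i\<in>UNIV. \<Sum>j\<in>UNIV. A $ i $ j *\<^sub>R axis i (axis j 1)) = A" for A :: "real^'n^'m"
  proof -
    have "(A $ i $ j *\<^sub>R axis i (axis j 1)) $ k $ l = (if k = i then if l = j then A $ i $ j else 0 else 0)"
      for i j k l by (simp add: axis_def)
    moreover have "(\<Sum>j\<in>UNIV. if k = i then if l = j then A $ i $ j else 0 else 0)
        = (if k = i then A $ i $ l else 0)" for i k l by simp
    ultimately show ?thesis by (simp add: vec_eq_iff)
  qed
  ultimately show ?thesis by simp
qed

lemma smooth_on_det:
  fixes f :: "'a::euclidean_space \<Rightarrow> real^'n^'n"
  assumes "open S" "\<And>i j. smooth_on S (\<lambda>x. f x $ i $ j)"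
  shows "smooth_on S (\<lambda>x. det (f x))"
  unfolding det_def
  using assms by (intro smooth_on_sum smooth_on_mult smooth_on_prod smooth_on_const) auto

section \<open>Symmetry of second derivatives\<close>

text \<open>Two applications of the mean value theorem: along \<open>u\<close> to the increment of
  \<open>f\<close> by \<open>t *\<^sub>R v\<close>, then along \<open>v\<close> to the directional
  derivative of \<open>f\<close> in direction \<open>u\<close>. The bound on \<open>t\<close> keeps
  the parallelogram inside the ball.\<close>

lemma second_difference_mean_value:
  fixes f :: "'a::euclidean_space \<Rightarrow> real"
  assumes S: "smooth_on (ball x e) f" and t: "0 < t" "t * (norm u + norm v) < e"
  obtains p where "p \<in> ball x e"
    "f (x + t *\<^sub>R u + t *\<^sub>R v) - f (x + t *\<^sub>R u) - f (x + t *\<^sub>R v) + f x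
      = t\<^sup>2 * frechet_derivative (\<lambda>y. frechet_derivative f (at y) u) (at p) v"
proof -
  define D where "D g w y = frechet_derivative g (at y) w" for g :: "'a \<Rightarrow> real" and w y
  have mem: "x + a *\<^sub>R u + b *\<^sub>R v \<in> ball x e" if "0 \<le> a" "a \<le> t" "0 \<le> b" "b \<le> t" for a b
  proof -
    have "norm (a *\<^sub>R u + b *\<^sub>R v) \<le> a * norm u + b * norm v"
      using norm_triangle_ineq[of "a *\<^sub>R u" "b *\<^sub>R v"] that by simp
    also have "\<dots> \<le> t * (norm u + norm v)"
      using that by (simp add: distrib_left add_mono mult_right_mono)
    finally have "norm (a *\<^sub>R u + b *\<^sub>R v) < e" using t by simp
    moreover have "x - (x + a *\<^sub>R u + b *\<^sub>R v) = - (a *\<^sub>R u + b *\<^sub>R v)" by simp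
    ultimately show ?thesis unfolding mem_ball dist_norm by (metis norm_minus_cancel)
  qed
  have der: "((\<lambda>s. g (c + s *\<^sub>R w)) has_field_derivative D g w (c + s *\<^sub>R w)) (at s)"
    if "smooth_on (ball x e) g" "c + s *\<^sub>R w \<in> ball x e" for g c w s
  proof -
    let ?d = "frechet_derivative g (at (c + s *\<^sub>R w))"
    have g: "(g has_derivative ?d) (at (c + s *\<^sub>R w))"
      by (rule smooth_on_has_derivative[OF that])
    have "((\<lambda>s. g (c + s *\<^sub>R w)) has_derivative (\<lambda>h. ?d (h *\<^sub>R w))) (at s)"
      by (rule has_derivative_compose[where f = "\<lambda>s. c + s *\<^sub>R w" and g = g, OF _ g])
         (auto intro!: derivative_eq_intros)
    moreover have "?d (h *\<^sub>R w) = D g w (c + s *\<^sub>R w) * h" for h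
      using has_derivative_linear[OF g] by (simp add: D_def linear_cmul)
    ultimately show ?thesis by (simp add: has_field_derivative_def)
  qed
  have "((\<lambda>s. f (x + t *\<^sub>R v + s *\<^sub>R u) - f (x + s *\<^sub>R u)) has_field_derivative
     D f u (x + t *\<^sub>R v + s *\<^sub>R u) - D f u (x + s *\<^sub>R u)) (at s)" if "0 \<le> s" "s \<le> t" for s
    using mem[of s t] mem[of s 0] that t
    by (intro DERIV_diff der S) (auto simp: algebra_simps)
  from MVT2[OF t(1) this] obtain z where z: "0 < z" "z < t"
    "f (x + t *\<^sub>R v + t *\<^sub>R u) - f (x + t *\<^sub>R u) - (f (x + t *\<^sub>R v) - f x)
      = t * (D f u (x + t *\<^sub>R v + z *\<^sub>R u) - D f u (x + z *\<^sub>R u))" by auto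
  have "((\<lambda>r. D f u (x + z *\<^sub>R u + r *\<^sub>R v)) has_field_derivative
      D (D f u) v (x + z *\<^sub>R u + r *\<^sub>R v)) (at r)" if "0 \<le> r" "r \<le> t" for r
    using mem[of z r] z that smooth_on_frechet_derivative[OF S, of u]
    by (intro der) (auto simp: D_def)
  from MVT2[OF t(1) this] obtain r where r: "0 < r" "r < t"
    "D f u (x + z *\<^sub>R u + t *\<^sub>R v) - D f u (x + z *\<^sub>R u) = t * D (D f u) v (x + z *\<^sub>R u + r *\<^sub>R v)" by auto
  have "x + z *\<^sub>R u + r *\<^sub>R v \<in> ball x e" using mem[of z r] z r by simp
  moreover have "f (x + t *\<^sub>R u + t *\<^sub>R v) - f (x + t *\<^sub>R u) - f (x + t *\<^sub>R v) + f x
      = t\<^sup>2 * D (D f u) v (x + z *\<^sub>R u + r *\<^sub>R v)"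
    using z(3) r(3) by (simp add: add_ac power2_eq_square)
  ultimately show thesis using that unfolding D_def by blast
qed

text \<open>The second difference is symmetric in \<open>u\<close> and \<open>v\<close>, so the two
  mixed derivatives agree at suitable points arbitrarily near \<open>x\<close>; continuity carries
  the equality to \<open>x\<close>.\<close>

lemma frechet_derivative_commute:
  fixes f :: "'a::euclidean_space \<Rightarrow> real"
  assumes "open S" "smooth_on S f" "x \<in> S"
  shows "frechet_derivative (\<lambda>y. frechet_derivative f (at y) u) (at x) v =
         frechet_derivative (\<lambda>y. frechet_derivative f (at y) v) (at x) u"
proof -
  define A where "A u v y = frechet_derivative (\<lambda>y. frechet_derivative f (at y) u) (at y) v" for u v y
  have cont: "isCont (A u v) x" for u v
  proof -
    have "continuous_on S (A u v)"
      unfolding A_def by (intro smooth_on_imp_continuous_on smooth_on_frechet_derivative assms)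
    then show ?thesis using assms continuous_on_eq_continuous_at by blast
  qed
  have "\<bar>A u v x - A v u x\<bar> \<le> d" if "d > 0" for d
  proof -
    obtain e1 where e1: "e1 > 0" "\<And>y. dist y x < e1 \<Longrightarrow> dist (A u v y) (A u v x) < d/2"
      using cont[of u v] \<open>d > 0\<close> half_gt_zero[of d] unfolding continuous_at_eps_delta by blast
    obtain e2 where e2: "e2 > 0" "\<And>y. dist y x < e2 \<Longrightarrow> dist (A v u y) (A v u x) < d/2"
      using cont[of v u] \<open>d > 0\<close> half_gt_zero[of d] unfolding continuous_at_eps_delta by blast
    obtain e3 where e3: "e3 > 0" "ball x e3 \<subseteq> S" using assms openE by blast
    define e where "e = min e1 (min e2 e3)"
    have e: "e > 0" using e1 e2 e3 by (simp add: e_def)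
    \<comment> \<open>Derivatives in \<open>Ck_on\<close> are two-sided and independent of the set,
      so smoothness restricts to subsets.\<close>
    have sm: "smooth_on (ball x e) f"
    proof -
      have "Ck_on k T g" if "Ck_on k S g" "T \<subseteq> S" for k T and g :: "'a \<Rightarrow> real"
        using that by (induction k arbitrary: g) (auto intro: continuous_on_subset)
      moreover have "ball x e \<subseteq> S" using e3 by (auto simp: e_def)
      ultimately show ?thesis using assms(2) by (simp add: smooth_on_def)
    qed
    \<comment> \<open>The summand 1 keeps the denominator positive even for zero vectors, and the
      factor 2 gives the bound \<open>e / 2\<close>, strictly below \<open>e\<close>.\<close>
    define t where "t = e / (2 * (norm u + norm v + 1))"
    have t: "t > 0" "t * (norm u + norm v) < e"
    proof -
      have n: "norm u + norm v + 1 > 0" by (intro add_nonneg_pos add_nonneg_nonneg) auto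
      then show "t > 0" using e by (simp add: t_def)
      have "t * (norm u + norm v) \<le> t * (norm u + norm v + 1)" using \<open>t > 0\<close> by simp
      also have "\<dots> = e / 2" using n by (simp add: t_def field_simps)
      finally show "t * (norm u + norm v) < e" using e by simp
    qed
    obtain p where p: "p \<in> ball x e" "f (x + t *\<^sub>R u + t *\<^sub>R v) - f (x + t *\<^sub>R u) - f (x + t *\<^sub>R v) + f x
      = t\<^sup>2 * A u v p"
      using second_difference_mean_value[OF sm t] unfolding A_def by blast
    obtain q where q: "q \<in> ball x e" "f (x + t *\<^sub>R v + t *\<^sub>R u) - f (x + t *\<^sub>R v) - f (x + t *\<^sub>R u) + f x
      = t\<^sup>2 * A v u q"
      using second_difference_mean_value[OF sm t(1), of v u] t(2) unfolding A_def
      by (metis add.commute)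
    have "t\<^sup>2 * A u v p = t\<^sup>2 * A v u q" using p(2) q(2) by (simp add: algebra_simps)
    then have "A u v p = A v u q" using t by simp
    moreover have "dist (A u v p) (A u v x) < d/2" "dist (A v u q) (A v u x) < d/2"
      using p q e1 e2 by (auto simp: e_def dist_commute)
    ultimately show ?thesis unfolding dist_real_def by linarith
  qed
  then have "\<bar>A u v x - A v u x\<bar> \<le> 0" by (rule dense_ge)
  then show ?thesis by (simp add: A_def)
qed

section \<open>Jacobi's formula and the Piola identity\<close>

lemma matrix_inv_mult:
  "invertible A \<Longrightarrow> A ** matrix_inv A = mat 1 \<and> matrix_inv A ** A = mat 1"
  unfolding invertible_def matrix_inv_def by (rule someI_ex)

lemma matrix_inv_unique:
  fixes A B :: "real^'n^'n"
  assumes "A ** B = mat 1"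
  shows "matrix_inv A = B"
proof -
  have "invertible A" using assms invertible_right_inverse by blast
  then have "matrix_inv A ** A = mat 1" by (simp add: matrix_inv_mult)
  then have "matrix_inv A ** (A ** B) = B" by (simp add: matrix_mul_assoc)
  then show ?thesis using assms by simp
qed

text \<open>Cramer's rule by rows: \<open>v v* matrix_inv A\<close> holds the coefficients of
  \<open>v\<close> in the rows of \<open>A\<close>. A unit vector \<open>v\<close> yields one entry
  of the adjugate, a differentiated row yields a term of Jacobi's formula.\<close>

lemma det_replace_row:
  fixes A :: "real^'n^'n"
  assumes "invertible A"
  shows "det (\<chi> i. if i = k then v else row i A) = (\<Sum>j\<in>UNIV. v $ j * (det A *\<^sub>R matrix_inv A) $ j $ k)"
proof -
  define c where "c = v v* matrix_inv A"
  have "c v* A = v"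
    using matrix_inv_mult[OF assms] by (simp add: c_def vector_matrix_mul_assoc)
  moreover have "(\<Sum>i\<in>UNIV. c $ i *s row i A) = c v* A"
    by (simp add: vec_eq_iff vector_matrix_mult_def row_def mult.commute)
  ultimately have v: "(\<Sum>i\<in>UNIV. c $ i *s row i A) = v" by simp
  have "det (\<chi> i. if i = k then v else row i A) = c $ k * det A"
    by (rule cramer_lemma_transpose[of k c A, unfolded v])
  then show ?thesis
    by (simp add: c_def vector_matrix_mult_def sum_distrib_left mult_ac)
qed

text \<open>The product rule in the Leibniz expansion differentiates one row at a time, and each
  resulting sum over permutations is again a determinant.\<close>

lemma has_derivative_det:
  fixes G :: "'a::euclidean_space \<Rightarrow> real^'n^'n"
  assumes "\<And>i j. ((\<lambda>y. G y $ i $ j) has_derivative G' i j) (at x)"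
  shows "((\<lambda>y. det (G y)) has_derivative
    (\<lambda>h. \<Sum>k\<in>UNIV. det (\<chi> i. if i = k then (\<chi> j. G' k j h) else row i (G x)))) (at x)"
proof -
  let ?P = "{p. p permutes (UNIV :: 'n set)}"
  have "((\<lambda>y. det (G y)) has_derivative
    (\<lambda>h. \<Sum>p\<in>?P. of_int (sign p) * (\<Sum>k\<in>UNIV. G' k (p k) h * (\<Prod>i\<in>UNIV - {k}. G x $ i $ p i)))) (at x)"
    unfolding det_def
    by (intro has_derivative_sum has_derivative_mult_right has_derivative_prod assms)
  moreover have "det (\<chi> i. if i = k then (\<chi> j. G' k j h) else row i (G x))
      = (\<Sum>p\<in>?P. of_int (sign p) * (G' k (p k) h * (\<Prod>i\<in>UNIV - {k}. G x $ i $ p i)))" for k h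
  proof -
    have "(\<Prod>i\<in>UNIV. (\<chi> i. if i = k then (\<chi> j. G' k j h) else row i (G x)) $ i $ p i)
      = G' k (p k) h * (\<Prod>i\<in>UNIV - {k}. G x $ i $ p i)" for p
      by (subst prod.remove[of _ k]) (auto simp: row_def intro!: prod.cong)
    then show ?thesis unfolding det_def by simp
  qed
  ultimately show ?thesis
    by (simp add: sum_distrib_left) (subst sum.swap, simp)
qed

section \<open>Partial derivatives, Jacobians and the chain rule in coordinates\<close>

lemma jacobian_nth:
  assumes "(f has_derivative f') (at x)"
  shows "jacobian f (at x) $ i $ j = f' (axis j 1) $ i"
  using frechet_derivative_at[OF assms] by (simp add: jacobian_def matrix_def)

lemma partial_eq:
  "(f has_derivative f') (at x) \<Longrightarrow> partial i f x = f' (axis i 1)"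
  using frechet_derivative_at[of f f' x] by (simp add: partial_def)

lemma partial_cong:
  assumes "f differentiable at x" "open U" "x \<in> U" "\<And>y. y \<in> U \<Longrightarrow> f y = g y"
  shows "partial i f x = partial i g x"
  using frechet_derivative_transform_within_open[OF assms] by (simp add: partial_def)

lemma partial_component:
  assumes "f differentiable (at x)"
  shows "partial j (\<lambda>y. f y $ i) x = jacobian f (at x) $ i $ j"
proof -
  obtain f' where f': "(f has_derivative f') (at x)" using assms unfolding differentiable_def by blast
  then show ?thesis
    using partial_eq[OF bounded_linear.has_derivative[OF bounded_linear_vec_nth f']]
    by (simp add: jacobian_nth[OF f'])
qed

text \<open>Linearity applied to the expansion of \<open>h\<close> in the standard basis. With the
  total derivative in this form, the coordinate chain rule is a mere composition.\<close>

lemma has_derivative_partial: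
  assumes "f differentiable (at x)"
  shows "(f has_derivative (\<lambda>h. \<Sum>i\<in>UNIV. partial i f x * h $ i)) (at x)"
proof -
  obtain f' where f': "(f has_derivative f') (at x)" using assms unfolding differentiable_def by blast
  interpret f': linear f' by (rule has_derivative_linear[OF f'])
  have "f' h = (\<Sum>i\<in>UNIV. partial i f x * h $ i)" for h
  proof -
    have "f' h = f' (\<Sum>i\<in>UNIV. h $ i *\<^sub>R axis i 1)"
      using basis_expansion[of h] by (simp add: scalar_mult_eq_scaleR)
    then show ?thesis by (simp add: f'.sum f'.scale partial_eq[OF f'] mult.commute)
  qed
  then show ?thesis using f' by (metis (no_types, lifting) ext)
qed

lemma partial_chain:
  assumes "h differentiable (at x)" "g differentiable (at (h x))"
  shows "partial j (\<lambda>y. g (h y)) x = (\<Sum>i\<in>UNIV. partial i g (h x) * jacobian h (at x) $ i $ j)"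
proof -
  obtain h' where h': "(h has_derivative h') (at x)" using assms unfolding differentiable_def by blast
  show ?thesis
    using partial_eq[OF has_derivative_compose[OF h' has_derivative_partial[OF assms(2)]]]
    by (simp add: jacobian_nth[OF h'])
qed

lemma smooth_on_differentiable: "smooth_on S f \<Longrightarrow> x \<in> S \<Longrightarrow> f differentiable (at x)"
  using smooth_on_has_derivative by (blast intro: differentiableI)

lemma smooth_on_partial: "smooth_on S f \<Longrightarrow> smooth_on S (partial i f)"
  unfolding partial_def by (rule smooth_on_frechet_derivative)

lemma smooth_on_nth: "open S \<Longrightarrow> smooth_on S f \<Longrightarrow> smooth_on S (\<lambda>x. f x $ i)"
  by (rule smooth_on_bounded_linear[OF _ bounded_linear_vec_nth])

lemma smooth_on_jacobian:
  fixes \<xi> :: "real^'n \<Rightarrow> real^'m"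
  assumes "open U" "smooth_on U \<xi>"
  shows "smooth_on U (\<lambda>y. jacobian \<xi> (at y) $ i $ j)"
  by (rule smooth_on_cong[OF assms(1) smooth_on_partial[OF smooth_on_nth[OF assms]]])
     (rule partial_component[OF smooth_on_differentiable[OF assms(2)]])

text \<open>Row \<open>l\<close> of the Jacobian consists of the partial derivatives of component
  \<open>l\<close>, so this is the symmetry of its second derivatives.\<close>

lemma partial_jacobian_commute:
  fixes \<xi> :: "real^'n \<Rightarrow> real^'n"
  assumes "open U" "smooth_on U \<xi>" "x \<in> U"
  shows "partial i (\<lambda>y. jacobian \<xi> (at y) $ l $ k) x = partial k (\<lambda>y. jacobian \<xi> (at y) $ l $ i) x"
proof -
  have "partial i (\<lambda>y. jacobian \<xi> (at y) $ l $ k) x = partial i (partial k (\<lambda>y. \<xi> y $ l)) x" for i k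
    by (rule partial_cong[OF smooth_on_differentiable[OF smooth_on_jacobian[OF assms(1,2)] assms(3)] assms(1,3)])
       (rule partial_component[symmetric, OF smooth_on_differentiable[OF assms(2)]])
  then show ?thesis
    using frechet_derivative_commute[OF assms(1) smooth_on_nth[OF assms(1,2)] assms(3)]
    by (simp add: partial_def[abs_def])
qed

text \<open>At points with invertible Jacobian this is the adjugate, the transposed cofactor matrix.
  Writing it with \<open>matrix_inv\<close> makes its product with the Jacobian immediate; the
  polynomial form comes from \<open>det_replace_row\<close>.\<close>

definition cofactor_field :: "(real^'n \<Rightarrow> real^'n) \<Rightarrow> real^'n \<Rightarrow> real^'n^'n" where
  "cofactor_field \<xi> y = det (jacobian \<xi> (at y)) *\<^sub>R matrix_inv (jacobian \<xi> (at y))"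

text \<open>By Cramer's rule entry \<open>(i, j)\<close> is the determinant of the Jacobian with row
  \<open>j\<close> replaced by the constant vector \<open>axis i 1\<close>, hence a polynomial in
  smooth entries.\<close>

lemma smooth_on_cofactor_field:
  fixes \<xi> :: "real^'n \<Rightarrow> real^'n"
  assumes U: "open U" "smooth_on U \<xi>" and inv: "\<And>y. y \<in> U \<Longrightarrow> invertible (jacobian \<xi> (at y))"
  shows "smooth_on U (cofactor_field \<xi>)"
proof (rule smooth_on_matrix[OF U(1)])
  fix i j
  let ?M = "\<lambda>y. (\<chi> k. if k = j then axis i 1 else row k (jacobian \<xi> (at y))) :: real^'n^'n"
  have "smooth_on U (\<lambda>y. det (?M y))"
  proof (rule smooth_on_det[OF U(1)])
    show "smooth_on U (\<lambda>y. ?M y $ a $ b)" for a b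
      using smooth_on_jacobian[OF U] by (cases "a = j") (auto simp: row_def smooth_on_const)
  qed
  then show "smooth_on U (\<lambda>y. cofactor_field \<xi> y $ i $ j)"
  proof (rule smooth_on_cong[OF U(1)])
    fix y assume "y \<in> U"
    have "det (?M y) = (\<Sum>l\<in>UNIV. if l = i then cofactor_field \<xi> y $ l $ j else 0)"
      unfolding det_replace_row[OF inv[OF \<open>y \<in> U\<close>]] cofactor_field_def
      by (intro sum.cong) (auto simp: axis_def)
    then show "det (?M y) = cofactor_field \<xi> y $ i $ j" by simp
  qed
qed

text \<open>Invertibility throughout \<open>U\<close> makes the product of the two matrices a scalar
  field times the identity near \<open>x\<close>, so that it can be differentiated; invertibility at
  \<open>x\<close> then cancels the Jacobian at the end.\<close>

lemma Piola_identity: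
  fixes \<xi> :: "real^'n \<Rightarrow> real^'n"
  assumes U: "open U" "smooth_on U \<xi>" and inv: "\<And>y. y \<in> U \<Longrightarrow> invertible (jacobian \<xi> (at y))"
    and x: "x \<in> U"
  shows "tensor_div (cofactor_field \<xi>) x = 0"
proof -
  define G where "G y = jacobian \<xi> (at y)" for y
  define C where "C = cofactor_field \<xi>"
  have dG: "((\<lambda>y. G y $ i $ j) has_derivative frechet_derivative (\<lambda>y. G y $ i $ j) (at x)) (at x)" for i j
    unfolding G_def by (rule smooth_on_has_derivative[OF smooth_on_jacobian[OF U] x])
  have dC: "((\<lambda>y. C y $ i $ j) has_derivative frechet_derivative (\<lambda>y. C y $ i $ j) (at x)) (at x)" for i j
    unfolding C_def
    by (intro smooth_on_has_derivative[OF _ x] smooth_on_nth U(1) smooth_on_cofactor_field U(2) inv)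
  have CG: "(\<Sum>l\<in>UNIV. C y $ i $ l * G y $ l $ k) = (if i = k then det (G y) else 0)"
    if "y \<in> U" for y i k
  proof -
    have "(C y ** G y) $ i $ k = (det (G y) *\<^sub>R mat 1) $ i $ k"
      using matrix_inv_mult[OF inv[OF that]]
      by (simp add: C_def cofactor_field_def G_def scalar_matrix_assoc[symmetric])
    then show ?thesis by (simp add: matrix_matrix_mult_def mat_def)
  qed
  \<comment> \<open>Entry \<open>(i, k)\<close> of the product is differentiated in direction
    \<open>i\<close>, its own row index. Off the diagonal the entry vanishes on all of
    \<open>U\<close>, so its derivative is 0.\<close>
  have row: "(\<Sum>l\<in>UNIV. C x $ i $ l * partial i (\<lambda>y. G y $ l $ k) x + partial i (\<lambda>y. C y $ i $ l) x * G x $ l $ k)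
      = (if i = k then partial k (\<lambda>y. det (G y)) x else 0)" for i k
  proof -
    let ?f = "\<lambda>y. \<Sum>l\<in>UNIV. C y $ i $ l * G y $ l $ k"
    have f: "(?f has_derivative (\<lambda>h. \<Sum>l\<in>UNIV. C x $ i $ l * frechet_derivative (\<lambda>y. G y $ l $ k) (at x) h
       + frechet_derivative (\<lambda>y. C y $ i $ l) (at x) h * G x $ l $ k)) (at x)"
      by (intro has_derivative_sum has_derivative_mult dG dC)
    have "partial i ?f x = partial i (\<lambda>y. if i = k then det (G y) else 0) x"
      using CG by (intro partial_cong[OF differentiableI[OF f] U(1) x])
    then show ?thesis using partial_eq[OF f, of i] by (auto simp: partial_def)
  qed
  \<comment> \<open>Jacobi's formula, with the derivative index moved from \<open>k\<close> to
    \<open>i\<close> by \<open>partial_jacobian_commute\<close> to match the first half of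
    \<open>row\<close>.\<close>
  have det: "partial k (\<lambda>y. det (G y)) x = (\<Sum>i\<in>UNIV. \<Sum>l\<in>UNIV. C x $ i $ l * partial i (\<lambda>y. G y $ l $ k) x)" for k
  proof -
    have rep: "det (\<chi> i. if i = l then v else row i (G x)) = (\<Sum>j\<in>UNIV. v $ j * C x $ j $ l)" for l v
      unfolding G_def C_def cofactor_field_def by (rule det_replace_row[OF inv[OF x]])
    have "partial k (\<lambda>y. det (G y)) x = (\<Sum>l\<in>UNIV. det (\<chi> i. if i = l
        then (\<chi> j. frechet_derivative (\<lambda>y. G y $ l $ j) (at x) (axis k 1)) else row i (G x)))"
      by (rule partial_eq[OF has_derivative_det[OF dG]])
    also have "\<dots> = (\<Sum>l\<in>UNIV. \<Sum>i\<in>UNIV. partial k (\<lambda>y. G y $ l $ i) x * C x $ i $ l)"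
      by (simp add: rep partial_def)
    also have "\<dots> = (\<Sum>i\<in>UNIV. \<Sum>l\<in>UNIV. C x $ i $ l * partial i (\<lambda>y. G y $ l $ k) x)"
      using partial_jacobian_commute[OF U x] by (subst sum.swap) (simp add: G_def mult.commute)
    finally show ?thesis .
  qed
  have "tensor_div C x v* G x = 0"
  proof -
    have "(\<Sum>l\<in>UNIV. tensor_div C x $ l * G x $ l $ k) = 0" for k
    proof -
      \<comment> \<open>Summing \<open>row\<close> over \<open>i\<close> leaves only the diagonal
        term on the right. By \<open>det\<close> it cancels the first half on the left, and the
        other half is the divergence times \<open>G x\<close>.\<close>
      have "(\<Sum>i\<in>UNIV. \<Sum>l\<in>UNIV. C x $ i $ l * partial i (\<lambda>y. G y $ l $ k) x
          + partial i (\<lambda>y. C y $ i $ l) x * G x $ l $ k) = partial k (\<lambda>y. det (G y)) x"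
        by (simp add: row)
      then have "(\<Sum>i\<in>UNIV. \<Sum>l\<in>UNIV. partial i (\<lambda>y. C y $ i $ l) x * G x $ l $ k) = 0"
        by (simp add: sum.distrib det)
      then show ?thesis
        unfolding tensor_div_def by (subst (asm) sum.swap) (simp add: sum_distrib_right)
    qed
    then show ?thesis by (simp add: vector_matrix_mult_def vec_eq_iff mult.commute)
  qed
  then have "tensor_div C x v* (G x ** matrix_inv (G x)) = 0"
    by (simp add: vector_matrix_mul_assoc[symmetric])
  then show ?thesis using matrix_inv_mult[OF inv[OF x]] by (simp add: C_def G_def)
qed

section \<open>The inverse deformation and the cloak parameters\<close>

lemma jacobian_inverse:
  fixes \<phi> \<xi> :: "real^'n \<Rightarrow> real^'n"
  assumes "open U" "x \<in> U" "\<And>y. y \<in> U \<Longrightarrow> \<phi> (\<xi> y) = y"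
    and "\<xi> differentiable (at x)" "\<phi> differentiable (at (\<xi> x))"
  shows "jacobian \<phi> (at (\<xi> x)) ** jacobian \<xi> (at x) = mat 1"
proof -
  have "((\<lambda>y. \<phi> (\<xi> y)) has_derivative
      (\<lambda>h. jacobian \<phi> (at (\<xi> x)) *v (jacobian \<xi> (at x) *v h))) (at x)"
    by (rule has_derivative_compose[OF iffD1[OF jacobian_works assms(4)] iffD1[OF jacobian_works assms(5)]])
  \<comment> \<open>The composition is the identity only on \<open>U\<close>; openness of
    \<open>U\<close> lets the derivative of the identity be transferred to it.\<close>
  moreover have "((\<lambda>y. \<phi> (\<xi> y)) has_derivative (\<lambda>h. h)) (at x)"
    by (rule has_derivative_transform_within_open[OF has_derivative_ident assms(1,2)])
       (simp add: assms(3))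
  ultimately have "(\<lambda>h. jacobian \<phi> (at (\<xi> x)) *v (jacobian \<xi> (at x) *v h)) = (\<lambda>h. h)"
    by (rule has_derivative_unique)
  then have "(jacobian \<phi> (at (\<xi> x)) ** jacobian \<xi> (at x)) *v h = mat 1 *v h" for h
    by (simp add: matrix_vector_mul_assoc fun_eq_iff)
  then show ?thesis unfolding matrix_eq by blast
qed

theorem lemma5:
  fixes \<Omega> \<omega> :: "(real^'d) set"
    and \<phi> \<xi> :: "real^'d \<Rightarrow> real^'d"
    and F V R :: "real^'d \<Rightarrow> real^'d^'d"
    and J :: "real^'d \<Rightarrow> real"
    and K :: "real^'d \<Rightarrow> real"
    and S :: "real^'d \<Rightarrow> real^'d^'d"
  assumes regions: "region \<Omega>" "region \<omega>"
    and deformation: "smooth_deformation \<Omega> \<omega> \<phi> \<xi>"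
    and F: "\<forall>X\<in>\<Omega>. F X = jacobian \<phi> (at X)"
    and J: "\<forall>X\<in>\<Omega>. J X = det (F X)"
    and J_pos: "\<forall>X\<in>\<Omega>. J X > 0"
    and polar: "\<forall>X\<in>\<Omega>. polar_decomposition (F X) (V X) (R X)"
    and pure_stretch: "\<forall>X\<in>\<Omega>. R X = mat 1"
    and K: "\<forall>x\<in>\<omega>. K x = J (\<xi> x)"
    and S: "\<forall>x\<in>\<omega>. S x = inverse (J (\<xi> x)) *\<^sub>R V (\<xi> x)"
  shows "admissible_cloak \<omega> (\<lambda>x. J (\<xi> x)) K S
    \<and> (\<forall>x\<in>\<omega>. cloak_density (J (\<xi> x)) (V (\<xi> x)) (S x) = inverse (J (\<xi> x)) *\<^sub>R mat 1)
    \<and> (\<forall>p :: real^'d \<Rightarrow> real. smooth_on \<omega> p \<longrightarrow>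
         (\<forall>x\<in>\<omega>. laplacian (\<lambda>X. p (\<phi> X)) (\<xi> x)
                 = contract_grad (V (\<xi> x)) (\<lambda>y. V (\<xi> y) *v grad p y) x))"
proof -
  have op: "open \<Omega>" "open \<omega>" using regions by (auto simp: region_def)
  have sm: "smooth_on \<Omega> \<phi>" "smooth_on \<omega> \<xi>"
    and mem: "\<And>X. X \<in> \<Omega> \<Longrightarrow> \<phi> X \<in> \<omega>" "\<And>x. x \<in> \<omega> \<Longrightarrow> \<xi> x \<in> \<Omega>"
    and inverse: "\<And>X. X \<in> \<Omega> \<Longrightarrow> \<xi> (\<phi> X) = X" "\<And>x. x \<in> \<omega> \<Longrightarrow> \<phi> (\<xi> x) = x"
    using deformation by (auto simp: smooth_deformation_def)
  note d\<phi> = smooth_on_differentiable[OF sm(1)] and d\<xi> = smooth_on_differentiable[OF sm(2)]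
  \<comment> \<open>The identity rotation turns \<open>F = V ** R\<close> into \<open>F = V\<close>,
    so the deformation gradient inherits the symmetry of \<open>V\<close>.\<close>
  have V: "V X = jacobian \<phi> (at X)" "symmetric_matrix (V X)" "det (V X) = J X" if "X \<in> \<Omega>" for X
    using that F J polar pure_stretch by (auto simp: polar_decomposition_def)
  have V_sym: "V X $ i $ j = V X $ j $ i" if "X \<in> \<Omega>" for X i j
    using V(2)[OF that] by (auto simp: symmetric_matrix_def transpose_def vec_eq_iff)
  have Jnz: "J X \<noteq> 0" if "X \<in> \<Omega>" for X using J_pos that by force
  have V_inv: "invertible (V X)" if "X \<in> \<Omega>" for X
    using V(3)[OF that] Jnz[OF that] by (simp add: invertible_det_nz)
  have VG: "V (\<xi> x) ** jacobian \<xi> (at x) = mat 1" if "x \<in> \<omega>" for x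
    using jacobian_inverse[OF op(2) that inverse(2) d\<xi>[OF that] d\<phi>[OF mem(2)[OF that]]]
    by (simp add: V(1) mem(2) that)
  have GV: "jacobian \<xi> (at x) ** V (\<xi> x) = mat 1" if "x \<in> \<omega>" for x
    using VG[OF that] matrix_left_right_inverse by blast
  have G_inv: "invertible (jacobian \<xi> (at x))" if "x \<in> \<omega>" for x
    using VG[OF that] GV[OF that] unfolding invertible_def by blast
  \<comment> \<open>The Jacobian of \<open>\<xi>\<close> is inverse to \<open>V\<close>, so its
    determinant is the reciprocal of \<open>J\<close> and its own inverse is
    \<open>V\<close>.\<close>
  have S_cof: "cofactor_field \<xi> x = S x" if "x \<in> \<omega>" for x
  proof -
    have "det (V (\<xi> x)) * det (jacobian \<xi> (at x)) = 1"
      using VG[OF that] by (simp flip: det_mul)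
    then have "det (jacobian \<xi> (at x)) = inverse (J (\<xi> x))"
      using V(3)[OF mem(2)[OF that]] inverse_unique by fastforce
    then show ?thesis
      using S that matrix_inv_unique[OF GV[OF that]] by (simp add: cofactor_field_def)
  qed
  have S_smooth: "smooth_on \<omega> S"
    by (rule smooth_on_cong[OF op(2) smooth_on_cofactor_field[OF op(2) sm(2) G_inv] S_cof])
  have S_div: "tensor_div S x = 0" if x: "x \<in> \<omega>" for x
  proof -
    \<comment> \<open>The two fields are known to agree only on \<open>\<omega>\<close>, so equality
      of their partial derivatives rests on \<open>\<omega>\<close> being open.\<close>
    have "partial i (\<lambda>y. S y $ i $ j) x = partial i (\<lambda>y. cofactor_field \<xi> y $ i $ j) x" for i j
      by (rule partial_cong[OF _ op(2) x])
         (simp_all add: S_cof smooth_on_differentiable[OF smooth_on_nth[OF op(2) smooth_on_nth[OF op(2) S_smooth]] x])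
    then have "tensor_div S x = tensor_div (cofactor_field \<xi>) x" by (simp add: tensor_div_def)
    then show ?thesis using Piola_identity[OF op(2) sm(2) G_inv x] by simp
  qed
  have S_sym: "symmetric_matrix (S x)" if "x \<in> \<omega>" for x
    using S that V(2)[OF mem(2)[OF that]]
    by (simp add: symmetric_matrix_def vec_eq_iff transpose_def)
  have S_inv: "invertible (S x)" if "x \<in> \<omega>" for x
  proof -
    \<comment> \<open>An explicit right inverse, which suffices for a square matrix.\<close>
    have "S x ** (J (\<xi> x) *\<^sub>R matrix_inv (V (\<xi> x))) = mat 1"
      using S that matrix_inv_mult[OF V_inv[OF mem(2)[OF that]]] Jnz[OF mem(2)[OF that]]
      by (simp add: matrix_scalar_ac scalar_matrix_assoc[symmetric])
    then show ?thesis unfolding invertible_right_inverse by blast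
  qed
  have density: "cloak_density (J (\<xi> x)) (V (\<xi> x)) (S x) = inverse (J (\<xi> x)) *\<^sub>R mat 1" if "x \<in> \<omega>" for x
  proof -
    note VV = matrix_inv_mult[OF V_inv[OF mem(2)[OF that]]]
    \<comment> \<open>Regrouping pairs each factor \<open>V\<close> of the two copies of
      \<open>S\<close> with one inverse. The scalars left over are \<open>J\<close> and two
      reciprocals of it.\<close>
    have "V (\<xi> x) ** (matrix_inv (V (\<xi> x)) ** matrix_inv (V (\<xi> x))) ** V (\<xi> x)
      = (V (\<xi> x) ** matrix_inv (V (\<xi> x))) ** (matrix_inv (V (\<xi> x)) ** V (\<xi> x))"
      by (simp add: matrix_mul_assoc)
    also have "\<dots> = mat 1" using VV by simp
    finally show ?thesis
      using S that Jnz[OF mem(2)[OF that]]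
      by (simp add: cloak_density_def matrix_scalar_ac scalar_matrix_assoc[symmetric])
  qed
  have laplace: "laplacian (\<lambda>X. p (\<phi> X)) (\<xi> x)
      = contract_grad (V (\<xi> x)) (\<lambda>y. V (\<xi> y) *v grad p y) x"
    if p: "smooth_on \<omega> p" and x: "x \<in> \<omega>" for p :: "real^'d \<Rightarrow> real" and x
  proof -
    define w where "w y = V (\<xi> y) *v grad p y" for y
    \<comment> \<open>\<open>V\<close> is controlled only on \<open>\<Omega>\<close>. Replacing it
      there by the Jacobian gives an expression with differentiable entries, from which
      \<open>dw\<close> transfers differentiability to \<open>w\<close>.\<close>
    have wj: "w y $ j = (\<Sum>i\<in>UNIV. jacobian \<phi> (at (\<xi> y)) $ j $ i * partial i p y)" if "y \<in> \<omega>" for y j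
      by (simp add: w_def grad_def matrix_vector_mult_def V(1) mem(2) that)
    have dw: "(\<lambda>y. w y $ j) differentiable (at y)" if y: "y \<in> \<omega>" for y j
    proof -
      have "(\<lambda>y. jacobian \<phi> (at (\<xi> y)) $ j $ i) differentiable (at y)" for i
        using differentiable_compose[OF _ d\<xi>[OF y], of "\<lambda>X. jacobian \<phi> (at X) $ j $ i"]
          smooth_on_differentiable[OF smooth_on_jacobian[OF op(1) sm(1)] mem(2)[OF y]] by blast
      then have "(\<lambda>y. \<Sum>i\<in>UNIV. jacobian \<phi> (at (\<xi> y)) $ j $ i * partial i p y) differentiable (at y)"
        using smooth_on_differentiable[OF smooth_on_partial[OF p] y]
        by (intro differentiable_sum differentiable_mult) auto
      then obtain D where "((\<lambda>y. \<Sum>i\<in>UNIV. jacobian \<phi> (at (\<xi> y)) $ j $ i * partial i p y) has_derivative D) (at y)"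
        unfolding differentiable_def by blast
      then have "((\<lambda>y. w y $ j) has_derivative D) (at y)"
        by (rule has_derivative_transform_within_open[OF _ op(2) y]) (simp add: wj)
      then show ?thesis by (rule differentiableI)
    qed
    \<comment> \<open>The chain rule gives the transpose of \<open>V\<close> times the gradient of
      \<open>p\<close>; symmetry of \<open>V\<close> turns this into \<open>w\<close>, which is thus
      the gradient in \<open>X\<close>.\<close>
    have first: "w (\<phi> X) $ j = partial j (\<lambda>X. p (\<phi> X)) X" if "X \<in> \<Omega>" for X j
      using partial_chain[OF d\<phi>[OF that] smooth_on_differentiable[OF p mem(1)[OF that]], of j]
        wj[OF mem(1)[OF that]] V_sym[OF that] V(1)[OF that] inverse(1)[OF that]
      by (simp add: mult.commute)
    have "partial j (partial j (\<lambda>X. p (\<phi> X))) (\<xi> x)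
        = (\<Sum>i\<in>UNIV. V (\<xi> x) $ i $ j * partial i (\<lambda>y. w y $ j) x)" for j
    proof -
      have dw': "(\<lambda>y. w y $ j) differentiable (at (\<phi> (\<xi> x)))" using dw[OF x] inverse(2)[OF x] by simp
      \<comment> \<open>The inner partial derivative is replaced by \<open>w\<close> composed with
        \<open>\<phi>\<close> on the open set \<open>\<Omega>\<close>; the second chain rule then
        contributes the other factor \<open>V\<close>.\<close>
      have "partial j (partial j (\<lambda>X. p (\<phi> X))) (\<xi> x) = partial j (\<lambda>X. w (\<phi> X) $ j) (\<xi> x)"
        using first differentiable_compose[OF dw' d\<phi>[OF mem(2)[OF x]]]
        by (intro partial_cong[OF _ op(1) mem(2)[OF x], symmetric])
      then show ?thesis
        using partial_chain[OF d\<phi>[OF mem(2)[OF x]] dw', of j]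
        by (simp add: V(1) mem(2) inverse(2) x mult.commute)
    qed
    then show ?thesis
      unfolding laplacian_def contract_grad_def w_def[symmetric]
      \<comment> \<open>The Laplacian has the component index \<open>j\<close> as its outer sum, the
        contraction has the derivative index \<open>i\<close>.\<close>
      by (subst sum.swap) simp
  qed
  show ?thesis
    using K S_smooth S_sym S_inv S_div density laplace by (simp add: admissible_cloak_def)
qed

end
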